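(* Let $F\in\mathbb{N}$ and let $t$ be an integer with $t\ge (F-1)/2$. Every almost symmetric numerical semigroup with Frobenius number $F$ and type $t$ is uniquely determined by its pseudo-Frobenius numbers; that is, if $S_1'$ and $S_2'$ are almost symmetric numerical semigroups with Frobenius number $F$ and type $t$ such that $\operatorname{PF}(S_1')=\operatorname{PF}(S_2')$, then $S_1'=S_2'$.
   Context: $\mathbb{N}$ is the set of nonnegative integers. A numerical semigroup is a submonoid $S$ of $(\mathbb{N},+)$ with finite complement in $\mathbb{N}$. The genus $\operatorname{g}(S)$ is the cardinality of $\mathbb{N}\setminus S$. The Frobenius number $\operatorname{F}(S)$ is the largest integer not in $S$. For $a,b\in\mathbb{Z}$ write $a\le_S b$ if $b-a\in S$; the set $\operatorname{PF}(S)$ of pseudo-Frobenius numbers is the set of maximal elements of $\mathbb{Z}\setminus S$ with respect to $\le_S$, and the type $\operatorname{t}(S)$ is its cardinality. $S$ is almost symmetric if for every integer $a\notin S$, either $\operatorname{F}(S)-a\in S\setminus\{0\}$ or $a\in\operatorname{PF}(S)$; equivalently, $\operatorname{g}(S)=(\operatorname{F}(S)+\operatorname{t}(S))/2$. *)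

theory Defs
  imports Complex_Main
begin

definition numerical_semigroup :: "nat set \<Rightarrow> bool" where
  "numerical_semigroup S \<longleftrightarrow>
     0 \<in> S \<and> (\<forall>a\<in>S. \<forall>b\<in>S. a + b \<in> S) \<and> finite (UNIV - S)"

text \<open>
  The Frobenius number, the order and the pseudo-Frobenius numbers refer to the integers, negative
  ones included, so \<open>S\<close> is embedded there as \<open>int ` S\<close>. In particular the Frobenius number of
  \<open>UNIV\<close> is \<open>-1\<close>.
\<close>

definition frobenius_number :: "nat set \<Rightarrow> int" where
  "frobenius_number S = (GREATEST a. a \<notin> int ` S)"

definition le_semigroup :: "nat set \<Rightarrow> int \<Rightarrow> int \<Rightarrow> bool" where
  "le_semigroup S a b \<longleftrightarrow> b - a \<in> int ` S"

definition pseudo_frobenius :: "nat set \<Rightarrow> int set" where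
  "pseudo_frobenius S =
     {a. a \<notin> int ` S \<and> (\<forall>b. b \<notin> int ` S \<longrightarrow> le_semigroup S a b \<longrightarrow> b = a)}"

definition semigroup_type :: "nat set \<Rightarrow> nat" where
  "semigroup_type S = card (pseudo_frobenius S)"

definition almost_symmetric :: "nat set \<Rightarrow> bool" where
  "almost_symmetric S \<longleftrightarrow>
     (\<forall>a. a \<notin> int ` S \<longrightarrow>
        frobenius_number S - a \<in> int ` S - {0} \<or> a \<in> pseudo_frobenius S)"

end

theory Submission
  imports Defs
begin

text \<open>
  Pseudo-Frobenius numbers are pairwise incongruent modulo every positive element \<open>s\<close> of \<open>S\<close>
  and, for \<open>F \<ge> 0\<close>, never divisible by \<open>s\<close>; hence the type \<open>t\<close> is at most \<open>s - 1\<close>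
  (\<open>semigroup_type_less\<close>). When \<open>t \<ge> (F - 1) / 2\<close> this places every positive element of \<open>S\<close>
  strictly above \<open>F / 2\<close>. If \<open>x > F / 2\<close> is a gap that is not pseudo-Frobenius, then almost
  symmetry makes \<open>F - x < F / 2\<close> a positive element of \<open>S\<close>, which is impossible. So \<open>S\<close> consists of
  \<open>0\<close> and of the numbers above \<open>F / 2\<close> outside \<open>PF(S)\<close>
  (\<open>almost_symmetric_high_type_mem_iff\<close>), a description that involves only \<open>F\<close> and \<open>PF(S)\<close>.
\<close>

lemma frobenius_number_greatest:
  assumes "numerical_semigroup S"
  shows "frobenius_number S \<notin> int ` S"
    and "a \<notin> int ` S \<Longrightarrow> a \<le> frobenius_number S"
proof -
  \<comment> \<open>Adding \<open>-1\<close> to the gaps keeps the set nonempty when \<open>S\<close> is all of the naturals.\<close>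
  define G where "G = insert (-1) (int ` (UNIV - S))"
  have fin: "finite G"
    using assms by (simp add: G_def numerical_semigroup_def)
  have gap: "Max G \<notin> int ` S"
    using Max_in[OF fin] by (auto simp: G_def)
  have ub: "a \<le> Max G" if "a \<notin> int ` S" for a
  proof (cases "a < 0")
    case True
    moreover have "-1 \<le> Max G"
      using fin by (simp add: G_def)
    ultimately show ?thesis by linarith
  next
    case False
    then have "a = int (nat a)" by simp
    with that have "a \<in> G"
      unfolding G_def by (metis DiffI UNIV_I imageI insertCI)
    then show ?thesis
      using fin by simp
  qed
  have "frobenius_number S = Max G"
    unfolding frobenius_number_def using gap ub by (intro Greatest_equality)
  with gap ub show "frobenius_number S \<notin> int ` S"
    and "a \<notin> int ` S \<Longrightarrow> a \<le> frobenius_number S"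
    by auto
qed

lemma mult_mem_numerical_semigroup:
  assumes "numerical_semigroup S" and "s \<in> S"
  shows "k * s \<in> S"
  using assms by (induction k) (auto simp: numerical_semigroup_def)

lemma pseudo_frobenius_nonneg:
  assumes S: "numerical_semigroup S" and F: "frobenius_number S \<ge> 0"
    and a: "a \<in> pseudo_frobenius S"
  shows "a \<ge> 0"
proof (rule ccontr)
  assume neg: "\<not> a \<ge> 0"
  \<comment> \<open>Then \<open>F - a > F\<close> lies in \<open>S\<close>, so \<open>a\<close> is not maximal among the gaps.\<close>
  have "frobenius_number S - a \<in> int ` S"
    using frobenius_number_greatest(2)[OF S, of "frobenius_number S - a"] neg by linarith
  then have "frobenius_number S = a"
    using a frobenius_number_greatest(1)[OF S]
    by (auto simp: pseudo_frobenius_def le_semigroup_def)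
  with neg F show False by simp
qed

lemma pseudo_frobenius_cong_imp_eq:
  assumes S: "numerical_semigroup S" and s: "s \<in> S"
    and a: "a \<in> pseudo_frobenius S" and b: "b \<notin> int ` S"
    and le: "a \<le> b" and cong: "a mod int s = b mod int s"
  shows "a = b"
proof -
  obtain k where k: "b - a = int s * k"
    using cong by (metis mod_eq_dvd_iff dvdE)
  have "b - a \<in> int ` S"
  proof (cases "k \<ge> 0")
    case True
    then have "b - a = int (nat k * s)"
      using k by simp
    then show ?thesis
      using mult_mem_numerical_semigroup[OF S s] by blast
  next
    case False
    then have "b - a \<le> 0"
      using k by (simp add: mult_nonneg_nonpos)
    then have "b - a = int 0"
      using le by simp
    then show ?thesis
      using S by (metis imageI numerical_semigroup_def)
  qed
  then show ?thesis
    using a b by (auto simp: pseudo_frobenius_def le_semigroup_def)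
qed

lemma semigroup_type_less:
  assumes S: "numerical_semigroup S" and F: "frobenius_number S \<ge> 0"
    and s: "s \<in> S" "s > 0"
  shows "semigroup_type S < s"
proof -
  let ?P = "pseudo_frobenius S"
  have inj: "inj_on (\<lambda>a. a mod int s) ?P"
  proof (rule inj_onI)
    fix a b assume ab: "a \<in> ?P" "b \<in> ?P" "a mod int s = b mod int s"
    then have "a \<notin> int ` S" "b \<notin> int ` S"
      by (auto simp: pseudo_frobenius_def)
    with ab show "a = b"
      using pseudo_frobenius_cong_imp_eq[OF S s(1), of a b]
        pseudo_frobenius_cong_imp_eq[OF S s(1), of b a]
      by (cases "a \<le> b") auto
  qed
  have "a mod int s \<noteq> 0" if a: "a \<in> ?P" for a
  proof
    assume "a mod int s = 0"
    then obtain k where k: "a = int s * k" by (auto simp: mod_eq_0_iff_dvd)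
    have "k \<ge> 0"
      using pseudo_frobenius_nonneg[OF S F a] s(2) k by (simp add: zero_le_mult_iff)
    then have "a = int (nat k * s)"
      using k by simp
    then have "a \<in> int ` S"
      using mult_mem_numerical_semigroup[OF S s(1)] by blast
    then show False
      using a by (simp add: pseudo_frobenius_def)
  qed
  moreover have "0 \<le> a mod int s" "a mod int s < int s" for a
    using s(2) by simp_all
  ultimately have "a mod int s \<in> {0<..<int s}" if "a \<in> ?P" for a
    using that by (metis greaterThanLessThan_iff order_le_imp_less_or_eq)
  then have "(\<lambda>a. a mod int s) ` ?P \<subseteq> {0<..<int s}"
    by blast
  then have "card ?P \<le> card {0<..<int s}"
    by (intro card_inj_on_le[OF inj]) auto
  then show ?thesis
    using s(2) by (simp add: semigroup_type_def)
qed

lemma almost_symmetric_high_type_mem_iff: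
  assumes S: "numerical_semigroup S" and sym: "almost_symmetric S"
    and F: "frobenius_number S \<ge> 0"
    and t: "frobenius_number S \<le> 2 * int (semigroup_type S) + 1"
  shows "x \<in> S \<longleftrightarrow>
    x = 0 \<or> (frobenius_number S < 2 * int x \<and> int x \<notin> pseudo_frobenius S)"
proof -
  have large: "frobenius_number S < 2 * int s" if "s \<in> S" "s > 0" for s
    using semigroup_type_less[OF S F that] t by linarith
  show ?thesis
  proof
    assume "x \<in> S"
    then show "x = 0 \<or> (frobenius_number S < 2 * int x \<and> int x \<notin> pseudo_frobenius S)"
      using large by (auto simp: pseudo_frobenius_def)
  next
    assume "x = 0 \<or> (frobenius_number S < 2 * int x \<and> int x \<notin> pseudo_frobenius S)"
    then show "x \<in> S"
    proof
      assume "x = 0"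
      then show ?thesis using S by (simp add: numerical_semigroup_def)
    next
      assume x: "frobenius_number S < 2 * int x \<and> int x \<notin> pseudo_frobenius S"
      show ?thesis
      proof (rule ccontr)
        assume "x \<notin> S"
        then have "int x \<notin> int ` S" by auto
        then have "frobenius_number S - int x \<in> int ` S - {0}"
          using sym x unfolding almost_symmetric_def by blast
        then obtain s where "s \<in> S" "s > 0" "frobenius_number S - int x = int s"
          by auto
        then show False
          using large[of s] x by linarith
      qed
    qed
  qed
qed

theorem corollary11:
  fixes F :: nat and t :: int and S1 S2 :: "nat set"
  assumes "real_of_int t \<ge> (real F - 1) / 2"
    and "numerical_semigroup S1" and "almost_symmetric S1"
    and "frobenius_number S1 = int F" and "int (semigroup_type S1) = t"
    and "numerical_semigroup S2" and "almost_symmetric S2"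
    and "frobenius_number S2 = int F" and "int (semigroup_type S2) = t"
    and "pseudo_frobenius S1 = pseudo_frobenius S2"
  shows "S1 = S2"
proof -
  have "real_of_int (int F) \<le> real_of_int (2 * t + 1)"
    using assms(1) by simp
  then have t: "int F \<le> 2 * t + 1"
    by (simp only: of_int_le_iff)
  have "x \<in> S1 \<longleftrightarrow> x \<in> S2" for x
    using almost_symmetric_high_type_mem_iff[OF assms(2,3), of x]
      almost_symmetric_high_type_mem_iff[OF assms(6,7), of x] assms(4,5,8,9,10) t
    by simp
  then show ?thesis by blast
qed

end
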